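(* Let $d\ge 1$. For any index set $T$, any vector-valued mean function $\boldsymbol{u}:T\to\mathbb{R}^d$, any covariance function $k:T\times T\to\mathbb{R}$, and any positive semi-definite parameter matrix $\Lambda\in\mathbb{R}^{d\times d}$, there exist a probability space $(\Omega,\mathcal{G},\mathcal{P})$ and a $d$-variate Gaussian process $\boldsymbol{f}=(\boldsymbol{f}(t))_{t\in T}$ on this space, with mean function $\boldsymbol{u}$, covariance function $k$ and parameter matrix $\Lambda$, such that: (1) $\mathbb{E}[\boldsymbol{f}(t)]=\boldsymbol{u}(t)$ for all $t\in T$; (2) $\mathbb{E}\left[(\boldsymbol{f}(t_s)-\boldsymbol{u}(t_s))(\boldsymbol{f}(t_l)-\boldsymbol{u}(t_l))^{\mathsf{T}}\right]=\mathrm{tr}(\Lambda)\,k(t_s,t_l)$ for all $t_s,t_l\in T$; (3) for all $n\ge 1$ and $t_1,\dots,t_n\in T$, $$\mathbb{E}\left[(F_{t_1,\dots,t_n}-M_{t_1,\dots,t_n})^{\mathsf{T}}(F_{t_1,\dots,t_n}-M_{t_1,\dots,t_n})\right]=\mathrm{tr}(K_{t_1,\dots,t_n})\,\Lambda,$$ where $M_{t_1,\dots,t_n}=[\boldsymbol{u}(t_1)^{\mathsf{T}},\dots,\boldsymbol{u}(t_n)^{\mathsf{T}}]^{\mathsf{T}}\in\mathbb{R}^{n\times d}$, $F_{t_1,\dots,t_n}=[\boldsymbol{f}(t_1)^{\mathsf{T}},\dots,\boldsymbol{f}(t_n)^{\mathsf{T}}]^{\mathsf{T}}\in\mathbb{R}^{n\times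 d}$, and $K_{t_1,\dots,t_n}=(k(t_i,t_j))_{i,j=1}^n\in\mathbb{R}^{n\times n}$.
   Context: Elements of $\mathbb{R}^d$ (in particular $\boldsymbol{u}(t)$ and $\boldsymbol{f}(t)$) are written as row vectors ($1\times d$), so that the quantity in (2) is a scalar and $M_{t_1,\dots,t_n}$, $F_{t_1,\dots,t_n}$ are the $n\times d$ matrices whose $i$-th rows are $\boldsymbol{u}(t_i)$ and $\boldsymbol{f}(t_i)$. A covariance function on $T$ is a symmetric function $k:T\times T\to\mathbb{R}$ such that every matrix $(k(t_i,t_j))_{i,j=1}^n$, with $n\geq 1$ and $t_1,\dots,t_n\in T$, is positive semi-definite. Positive semi-definite matrices are understood to be symmetric. Gaussian measure on $\mathbb{R}^{n\times d}$: a Borel probability measure $\gamma$ on $\mathbb{R}^{n\times d}$ is Gaussian if and only if, for each $\boldsymbol{a}\in\mathbb{R}^{nd}$, the random variable $\boldsymbol{x}\mapsto\langle\boldsymbol{a},\mathrm{vec}(\boldsymbol{x})\rangle$ on $(\mathbb{R}^{n\times d},\mathcal{B}(\mathbb{R}^{n\times d}),\gamma)$ is Gaussian, where $\mathrm{vec}$ denotes vectorisation (column stacking) and degenerate (constant) Gaussian variables are allowed. Let $(\mathbb{R}^d)_T$ be the space of all functions $T\to\mathbb{R}^d$ with the $\sigma$-algebra generated by the cylinder sets $\{\boldsymbol{f}:\boldsymbol{f}(t_i)\in B_i,\ 1\le i\le n\}$ ($n\ge1$, $t_i\in T$, $B_i\subseteq\mathbb{R}^d$ Borel). A measure $\gamma$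 on $(\mathbb{R}^d)_T$ is a Gaussian measure if for all $n\ge1$ and $t_1,\dots,t_n\in T$, its push-forward under $\boldsymbol{f}\mapsto[\boldsymbol{f}(t_1)^{\mathsf{T}},\dots,\boldsymbol{f}(t_n)^{\mathsf{T}}]^{\mathsf{T}}$ is a Gaussian measure on $\mathbb{R}^{n\times d}$. A $d$-variate Gaussian process indexed by $T$ is an $\mathbb{R}^d$-valued process whose law on $(\mathbb{R}^d)_T$ is a Gaussian measure (equivalently, the coordinate process under such a measure). A process as in the claim is denoted $\boldsymbol{f}\sim\mathcal{MGP}_d(\boldsymbol{u},k,\Lambda)$. *)

theory Defs
  imports "HOL-Probability.Probability"
begin

text \<open>
  The space of n-by-d matrices is modelled with the row dimension as a natural number and the
  column dimension as a finite type: such a matrix is a function from \<open>{..<n}\<close> to its rows in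
  \<open>real ^ 'd\<close>. As \<open>real ^ 'd\<close> is second countable, the product sigma-algebra below is the
  Borel sigma-algebra of the space of n-by-d matrices.
\<close>

definition borel_mat :: "nat \<Rightarrow> (nat \<Rightarrow> real ^ 'd::finite) measure" where
  "borel_mat n = (\<Pi>\<^sub>M i\<in>{..<n}. borel)"

definition stack_rows :: "nat \<Rightarrow> ('i \<Rightarrow> real ^ 'd) \<Rightarrow> (nat \<Rightarrow> 'i) \<Rightarrow> nat \<Rightarrow> real ^ 'd" where
  "stack_rows n f t = (\<lambda>i\<in>{..<n}. f (t i))"

definition transpose_mult ::
    "nat \<Rightarrow> (nat \<Rightarrow> real ^ 'd) \<Rightarrow> (nat \<Rightarrow> real ^ 'd) \<Rightarrow> real ^ 'd ^ 'd" where
  "transpose_mult n X Y = (\<chi> a b. \<Sum>i<n. X i $ a * Y i $ b)"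

text \<open>
  Vectorisation of an n-by-d matrix. The entries of a vector of length \<open>n * d\<close> are indexed by
  \<open>{..<n} \<times> (UNIV :: 'd set)\<close>, so no ordering of the positions has to be chosen.
\<close>

definition vec_mat :: "(nat \<Rightarrow> real ^ 'd) \<Rightarrow> nat \<times> 'd \<Rightarrow> real" where
  "vec_mat x = (\<lambda>(i, j). x i $ j)"

definition inner_vec :: "nat \<Rightarrow> (nat \<times> 'd::finite \<Rightarrow> real) \<Rightarrow> (nat \<times> 'd \<Rightarrow> real) \<Rightarrow> real" where
  "inner_vec n a b = (\<Sum>p\<in>{..<n} \<times> UNIV. a p * b p)"

text \<open>
  Meant for finite \<open>I\<close> only; it includes symmetry.
\<close>

definition psd_matrix :: "'a set \<Rightarrow> ('a \<Rightarrow> 'a \<Rightarrow> real) \<Rightarrow> bool" where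
  "psd_matrix I A \<longleftrightarrow>
     (\<forall>i\<in>I. \<forall>j\<in>I. A i j = A j i) \<and>
     (\<forall>x :: 'a \<Rightarrow> real. 0 \<le> (\<Sum>i\<in>I. \<Sum>j\<in>I. x i * A i j * x j))"

definition covariance_function :: "'i set \<Rightarrow> ('i \<Rightarrow> 'i \<Rightarrow> real) \<Rightarrow> bool" where
  "covariance_function T k \<longleftrightarrow>
     (\<forall>s\<in>T. \<forall>t\<in>T. k s t = k t s) \<and>
     (\<forall>n\<ge>1. \<forall>t :: nat \<Rightarrow> 'i. (\<forall>i<n. t i \<in> T) \<longrightarrow> psd_matrix {..<n} (\<lambda>i j. k (t i) (t j)))"

text \<open>
  The library's \<open>normal_density\<close> is a density only for positive standard deviation; the second
  disjunct is the degenerate (almost surely constant) case.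
\<close>

definition gaussian_rv :: "'a measure \<Rightarrow> ('a \<Rightarrow> real) \<Rightarrow> bool" where
  "gaussian_rv M X \<longleftrightarrow>
     (\<exists>\<mu> \<sigma>. 0 < \<sigma> \<and> distributed M lborel X (normal_density \<mu> \<sigma>)) \<or>
     (X \<in> borel_measurable M \<and> (\<exists>c. distr M borel X = return borel c))"

definition gaussian_mat_measure :: "nat \<Rightarrow> (nat \<Rightarrow> real ^ 'd::finite) measure \<Rightarrow> bool" where
  "gaussian_mat_measure n \<gamma> \<longleftrightarrow>
     sets \<gamma> = sets (borel_mat n) \<and> prob_space \<gamma> \<and>
     (\<forall>a :: nat \<times> 'd \<Rightarrow> real. gaussian_rv \<gamma> (\<lambda>x. inner_vec n a (vec_mat x)))"

text \<open>
  Functions on \<open>T\<close> are the extensional functions (\<open>undefined\<close> outside \<open>T\<close>); the product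
  sigma-algebra is the one generated by the cylinder sets.
\<close>

definition path_space :: "'i set \<Rightarrow> ('i \<Rightarrow> real ^ 'd::finite) measure" where
  "path_space T = (\<Pi>\<^sub>M t\<in>T. borel)"

definition gaussian_path_measure :: "'i set \<Rightarrow> ('i \<Rightarrow> real ^ 'd::finite) measure \<Rightarrow> bool" where
  "gaussian_path_measure T \<gamma> \<longleftrightarrow>
     sets \<gamma> = sets (path_space T) \<and>
     (\<forall>n\<ge>1. \<forall>t :: nat \<Rightarrow> 'i. (\<forall>i<n. t i \<in> T) \<longrightarrow>
        gaussian_mat_measure n (distr \<gamma> (borel_mat n) (\<lambda>f. stack_rows n f t)))"

definition gaussian_process ::
    "'w measure \<Rightarrow> 'i set \<Rightarrow> ('i \<Rightarrow> 'w \<Rightarrow> real ^ 'd::finite) \<Rightarrow> bool" where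
  "gaussian_process P T f \<longleftrightarrow>
     (\<forall>t\<in>T. f t \<in> borel_measurable P) \<and>
     gaussian_path_measure T (distr P (path_space T) (\<lambda>\<omega>. \<lambda>t\<in>T. f t \<omega>))"

end

theory Submission
  imports Defs
begin

text \<open>
  Finite-dimensional centred Gaussian laws are linear images of independent standard normals, via a
  factorisation of the covariance matrix. A law on a finite product of real lines is determined by
  its characteristic function, so these laws are consistent, and the Daniell-Kolmogorov theorem
  yields a centred Gaussian process for every positive semi-definite kernel on any index set.
  Applied to \<open>T \<times> UNIV\<close> with the kernel \<open>k s t * \<Lambda> $ a $ b\<close> this gives all entries of
  \<open>f t - u t\<close> simultaneously; the moment identities are then entrywise covariances, summed up.
\<close>

text \<open>Both \<open>k\<close> and \<open>\<Lambda>\<close> may be singular, so the proof cannot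
  rely on densities or on inverse covariance matrices. A law is described by its transform instead,
  the exponential of minus half a quadratic form, which makes sense in the degenerate case too. The
  obstacle is uniqueness from the transform in several variables, because
  \<open>Levy_uniqueness\<close> concerns one real variable. It is applied to one coordinate under a
  measure reweighted by a function of the others. Such a weight has to be nonnegative, whereas the
  exponential of the remaining coordinates is complex; this is what brings in the shifted cosine and
  sine. Beyond consistency no joint law has to be identified: Gaussianity is tested on scalar linear
  combinations, and mixed second moments come from squares of such combinations.\<close>

section \<open>Uniqueness of finite-dimensional laws from their transforms\<close>

lemma cos_eq_iexp: "complex_of_real (cos y) = (iexp y + iexp (-y)) / 2"
  by (simp add: cos_exp_eq flip: cos_of_real)

lemma sin_eq_iexp: "complex_of_real (sin y) = (iexp y - iexp (-y)) / (2 * \<i>)"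
  by (simp add: sin_exp_eq flip: sin_of_real)

text \<open>Normalising a nonnegative weight by its mass gives a probability density, so weighted
  integrals become the characteristic function and the probabilities of a genuine real law.\<close>

lemma weighted_law:
  fixes X W :: "'a \<Rightarrow> real"
  assumes [measurable]: "X \<in> borel_measurable M" and int: "integrable M W"
    and W: "\<And>x. 0 \<le> W x" and c: "0 < c" and c_eq: "c = (\<integral>x. W x \<partial>M)"
  defines "L \<equiv> distr (density M (\<lambda>x. ennreal (W x / c))) borel X"
  shows "real_distribution L"
    and "char L t = (\<integral>x. W x *\<^sub>R iexp (t * X x) \<partial>M) / of_real c"
    and "B \<in> sets borel \<Longrightarrow> measure L B = (\<integral>x. indicator B (X x) * W x \<partial>M) / c"
proof -
  have [measurable]: "W \<in> borel_measurable M" using int by simp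
  have "(\<integral>\<^sup>+x. ennreal (W x / c) \<partial>M) = ennreal (\<integral>x. W x / c \<partial>M)"
    using W c int by (intro nn_integral_eq_integral) auto
  also have "\<dots> = 1" using c by (simp flip: c_eq)
  finally have "prob_space (density M (\<lambda>x. ennreal (W x / c)))"
    by (intro prob_spaceI) (simp add: emeasure_density cong: nn_integral_cong)
  then have "prob_space L"
    unfolding L_def by (rule prob_space.prob_space_distr) simp
  then show rd: "real_distribution L"
    by (simp add: real_distribution_def real_distribution_axioms_def L_def)
  show "char L t = (\<integral>x. W x *\<^sub>R iexp (t * X x) \<partial>M) / of_real c"
    unfolding char_def L_def using W c
    by (simp add: integral_distr integral_density divide_inverse ac_simps scaleR_conv_of_real
          flip: integral_mult_right_zero)
  show "measure L B = (\<integral>x. indicator B (X x) * W x \<partial>M) / c" if [measurable]: "B \<in> sets borel"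
  proof -
    have "measure L B = (\<integral>x. indicator B x \<partial>L)"
      by (simp add: L_def)
    also have "\<dots> = (\<integral>x. indicator B (X x) * W x \<partial>M) / c"
      unfolding L_def using W c
      by (subst integral_distr, simp, simp, subst integral_density)
         (simp_all add: mult.commute)
    finally show ?thesis .
  qed
qed

text \<open>At \<open>t = 0\<close> the hypothesis says that both weights have the same mass
  \<open>c\<close>. If \<open>c = 0\<close>, both sides are squeezed between 0 and the mass;
  otherwise dividing by \<open>c\<close> reduces the claim to Levy's theorem.\<close>

lemma weighted_law_unique:
  fixes X1 W1 :: "'a \<Rightarrow> real" and X2 W2 :: "'b \<Rightarrow> real"
  assumes [measurable]: "X1 \<in> borel_measurable M1" "X2 \<in> borel_measurable M2"
    and int1: "integrable M1 W1" and int2: "integrable M2 W2"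
    and W: "\<And>x. 0 \<le> W1 x" "\<And>x. 0 \<le> W2 x"
    and eq: "\<And>t. (\<integral>x. W1 x *\<^sub>R iexp (t * X1 x) \<partial>M1) = (\<integral>x. W2 x *\<^sub>R iexp (t * X2 x) \<partial>M2)"
    and [measurable]: "B \<in> sets borel"
  shows "(\<integral>x. indicator B (X1 x) * W1 x \<partial>M1) = (\<integral>x. indicator B (X2 x) * W2 x \<partial>M2)"
proof -
  have [measurable]: "W1 \<in> borel_measurable M1" "W2 \<in> borel_measurable M2"
    using int1 int2 by simp_all
  define c where "c = (\<integral>x. W1 x \<partial>M1)"
  have c2: "c = (\<integral>x. W2 x \<partial>M2)"
    using eq[of 0] by (simp add: c_def scaleR_conv_of_real)
  have c_nonneg: "0 \<le> c" unfolding c_def using W by (intro integral_nonneg_AE) auto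
  show ?thesis
  proof (cases "c = 0")
    case True
    have "(\<integral>x. indicator B (X1 x) * W1 x \<partial>M1) \<le> (\<integral>x. W1 x \<partial>M1)"
      using W by (intro integral_mono' int1) (auto simp: indicator_def)
    moreover have "0 \<le> (\<integral>x. indicator B (X1 x) * W1 x \<partial>M1)"
      using W by (intro integral_nonneg_AE) auto
    moreover have "(\<integral>x. indicator B (X2 x) * W2 x \<partial>M2) \<le> (\<integral>x. W2 x \<partial>M2)"
      using W by (intro integral_mono' int2) (auto simp: indicator_def)
    moreover have "0 \<le> (\<integral>x. indicator B (X2 x) * W2 x \<partial>M2)"
      using W by (intro integral_nonneg_AE) auto
    ultimately show ?thesis using True c2 c_def by auto
  next
    case False
    with c_nonneg have c: "0 < c" by simp
    note L1 = weighted_law[OF _ int1 W(1) c c_def] and L2 = weighted_law[OF _ int2 W(2) c c2]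
    have "distr (density M1 (\<lambda>x. ennreal (W1 x / c))) borel X1 =
          distr (density M2 (\<lambda>x. ennreal (W2 x / c))) borel X2"
      by (rule Levy_uniqueness) (simp_all add: L1 L2 eq fun_eq_iff del: of_real_mult)
    then show ?thesis
      using L1(3)[of X1 B] L2(3)[of X2 B] c by simp
  qed
qed

lemma integrable_scaleR_iexp:
  fixes V Z :: "'a \<Rightarrow> real"
  assumes V: "integrable M V" and [measurable]: "Z \<in> borel_measurable M"
  shows "integrable M (\<lambda>x. V x *\<^sub>R iexp (Z x))"
proof (rule Bochner_Integration.integrable_bound[OF V])
  have [measurable]: "V \<in> borel_measurable M" using V by simp
  show "(\<lambda>x. V x *\<^sub>R iexp (Z x)) \<in> borel_measurable M" by measurable
qed simp

text \<open>By Euler's formulas the transform of \<open>X\<close> under a trigonometric weight in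
  \<open>Y\<close> only involves the joint transform of \<open>X\<close> and \<open>Y\<close> at the
  frequencies 0, 1 and -1 of \<open>Y\<close>. Equal joint transforms therefore give equal weighted
  ones.\<close>

lemma integral_trig_weight:
  fixes X Y V :: "'a \<Rightarrow> real" and t :: real
  assumes [measurable]: "X \<in> borel_measurable M" "Y \<in> borel_measurable M"
    and V: "integrable M V"
  defines "J \<equiv> \<lambda>r. \<integral>x. V x *\<^sub>R iexp (t * X x + r * Y x) \<partial>M"
  shows "(\<integral>x. (V x * (1 + cos (Y x))) *\<^sub>R iexp (t * X x) \<partial>M) = J 0 + (J 1 + J (-1)) / 2"
    and "(\<integral>x. (V x * (1 + sin (Y x))) *\<^sub>R iexp (t * X x) \<partial>M) = J 0 + (J 1 - J (-1)) / (2 * \<i>)"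
proof -
  have int: "integrable M (\<lambda>x. V x *\<^sub>R iexp (t * X x + r * Y x))" for r
    by (rule integrable_scaleR_iexp[OF V]) simp
  have "(V x * (1 + cos (Y x))) *\<^sub>R iexp (t * X x) =
      V x *\<^sub>R iexp (t * X x + 0 * Y x) +
      (V x *\<^sub>R iexp (t * X x + 1 * Y x) + V x *\<^sub>R iexp (t * X x + (-1) * Y x)) / 2" for x
    by (simp add: scaleR_conv_of_real cos_eq_iexp ring_distribs exp_add exp_diff exp_minus field_simps)
  then show "(\<integral>x. (V x * (1 + cos (Y x))) *\<^sub>R iexp (t * X x) \<partial>M) = J 0 + (J 1 + J (-1)) / 2"
    unfolding J_def using int[of 0] int[of 1] int[of "-1"] by simp
  have "(V x * (1 + sin (Y x))) *\<^sub>R iexp (t * X x) =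
      V x *\<^sub>R iexp (t * X x + 0 * Y x) +
      (V x *\<^sub>R iexp (t * X x + 1 * Y x) - V x *\<^sub>R iexp (t * X x + (-1) * Y x)) / (2 * \<i>)" for x
    by (simp add: scaleR_conv_of_real sin_eq_iexp ring_distribs exp_add exp_diff exp_minus field_simps)
  then show "(\<integral>x. (V x * (1 + sin (Y x))) *\<^sub>R iexp (t * X x) \<partial>M) = J 0 + (J 1 - J (-1)) / (2 * \<i>)"
    unfolding J_def using int[of 0] int[of 1] int[of "-1"] by simp
qed

text \<open>The exchange step for several coordinates: \<open>X\<close> is the coordinate being
  converted, \<open>V\<close> carries the indicators already obtained, and \<open>Y\<close> is the
  linear combination of the coordinates still in the exponent.\<close>

lemma indicator_iexp_unique:
  fixes X1 Y1 V1 :: "'a \<Rightarrow> real" and X2 Y2 V2 :: "'a \<Rightarrow> real"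
  assumes m [measurable]: "X1 \<in> borel_measurable M1" "Y1 \<in> borel_measurable M1"
      "X2 \<in> borel_measurable M2" "Y2 \<in> borel_measurable M2"
    and int1: "integrable M1 V1" and int2: "integrable M2 V2"
    and V: "\<And>x. 0 \<le> V1 x" "\<And>x. 0 \<le> V2 x"
    and eq: "\<And>t r. (\<integral>x. V1 x *\<^sub>R iexp (t * X1 x + r * Y1 x) \<partial>M1) =
                   (\<integral>x. V2 x *\<^sub>R iexp (t * X2 x + r * Y2 x) \<partial>M2)"
    and B [measurable]: "B \<in> sets borel"
  shows "(\<integral>x. (indicator B (X1 x) * V1 x) *\<^sub>R iexp (Y1 x) \<partial>M1) =
         (\<integral>x. (indicator B (X2 x) * V2 x) *\<^sub>R iexp (Y2 x) \<partial>M2)"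
proof -
  have bnd: "0 \<le> 1 + cos y" "0 \<le> 1 + sin y" for y :: real
    using cos_ge_minus_one[of y] sin_ge_minus_one[of y] by linarith+
  have int: "integrable M (\<lambda>x. V x * cos (Z x))" "integrable M (\<lambda>x. V x * sin (Z x))"
      "integrable M (\<lambda>x. indicator B (Z x) * V x)"
    if V: "integrable M V" and [measurable]: "Z \<in> borel_measurable M"
    for M :: "'a measure" and V Z :: "'a \<Rightarrow> real"
  proof -
    have [measurable]: "V \<in> borel_measurable M" using V by simp
    show "integrable M (\<lambda>x. V x * cos (Z x))" "integrable M (\<lambda>x. V x * sin (Z x))"
      "integrable M (\<lambda>x. indicator B (Z x) * V x)"
      by (rule Bochner_Integration.integrable_bound[OF V];
          simp add: abs_mult mult_left_le indicator_def)+
  qed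
  have int': "integrable M (\<lambda>x. V x * (1 + cos (Z x)))" "integrable M (\<lambda>x. V x * (1 + sin (Z x)))"
    if "integrable M V" "Z \<in> borel_measurable M" for M :: "'a measure" and V Z :: "'a \<Rightarrow> real"
    using that int(1,2)[OF that] by (simp_all add: distrib_left)
  note trig_eq = integral_trig_weight[OF m(1,2) int1] integral_trig_weight[OF m(3,4) int2] eq
  \<comment> \<open>\<open>V\<close>, \<open>V * (1 + cos Y)\<close> and \<open>V * (1 + sin Y)\<close> are nonnegative weights, to which one-dimensional
    uniqueness applies; \<open>V * iexp Y\<close> is a linear combination of them.\<close>
  have 0: "(\<integral>x. indicator B (X1 x) * V1 x \<partial>M1) = (\<integral>x. indicator B (X2 x) * V2 x \<partial>M2)"
    using eq[of _ 0] by (intro weighted_law_unique m int1 int2 V B) simp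
  have c: "(\<integral>x. indicator B (X1 x) * (V1 x * (1 + cos (Y1 x))) \<partial>M1) =
        (\<integral>x. indicator B (X2 x) * (V2 x * (1 + cos (Y2 x))) \<partial>M2)"
    by (rule weighted_law_unique[OF m(1,3) _ _ _ _ _ B])
       (simp_all only: trig_eq, simp_all add: int1 int2 int' V bnd)
  have s: "(\<integral>x. indicator B (X1 x) * (V1 x * (1 + sin (Y1 x))) \<partial>M1) =
        (\<integral>x. indicator B (X2 x) * (V2 x * (1 + sin (Y2 x))) \<partial>M2)"
    by (rule weighted_law_unique[OF m(1,3) _ _ _ _ _ B])
       (simp_all only: trig_eq, simp_all add: int1 int2 int' V bnd)
  \<comment> \<open>Euler's formula, with cosine and sine each written as the shifted nonnegative
    weight minus the constant one.\<close>
  have split: "(\<integral>x. (indicator B (X x) * V x) *\<^sub>R iexp (Y x) \<partial>M) =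
      of_real ((\<integral>x. indicator B (X x) * (V x * (1 + cos (Y x))) \<partial>M) - (\<integral>x. indicator B (X x) * V x \<partial>M)) +
      \<i> * of_real ((\<integral>x. indicator B (X x) * (V x * (1 + sin (Y x))) \<partial>M) - (\<integral>x. indicator B (X x) * V x \<partial>M))"
    if V: "integrable M V" and [measurable]: "X \<in> borel_measurable M" "Y \<in> borel_measurable M"
    for M :: "'a measure" and V X Y :: "'a \<Rightarrow> real"
  proof -
    let ?U = "\<lambda>x. indicator B (X x) * V x"
    have U: "integrable M ?U" by (rule int) fact+
    have "(\<integral>x. ?U x *\<^sub>R iexp (Y x) \<partial>M) =
        (\<integral>x. of_real (?U x * cos (Y x)) + \<i> * of_real (?U x * sin (Y x)) \<partial>M)"
      by (intro Bochner_Integration.integral_cong refl)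
         (simp add: scaleR_conv_of_real exp_Euler cos_of_real sin_of_real ring_distribs)
    also have "\<dots> = of_real (\<integral>x. ?U x * cos (Y x) \<partial>M) + \<i> * of_real (\<integral>x. ?U x * sin (Y x) \<partial>M)"
      using int[OF U that(3)] by (subst Bochner_Integration.integral_add) (auto simp del: of_real_mult)
    also have "(\<integral>x. ?U x * cos (Y x) \<partial>M) =
        (\<integral>x. indicator B (X x) * (V x * (1 + cos (Y x))) \<partial>M) - (\<integral>x. ?U x \<partial>M)"
      using int[OF U that(3)] U by (simp add: ring_distribs mult.assoc)
    also have "(\<integral>x. ?U x * sin (Y x) \<partial>M) =
        (\<integral>x. indicator B (X x) * (V x * (1 + sin (Y x))) \<partial>M) - (\<integral>x. ?U x \<partial>M)"
      using int[OF U that(3)] U by (simp add: ring_distribs mult.assoc)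
    finally show ?thesis .
  qed
  show ?thesis
    by (simp only: split int1 int2 m 0 c s)
qed

text \<open>Once every coordinate has been exchanged, the integral is the measure of a box, and
  boxes are an intersection-stable generator of the product sigma-algebra.\<close>

lemma measure_eqI_char_PiM:
  fixes M1 M2 :: "('i \<Rightarrow> real) measure"
  assumes I: "finite I" and M1: "prob_space M1" and M2: "prob_space M2"
    and sets [measurable_cong]: "sets M1 = sets (\<Pi>\<^sub>M i\<in>I. borel)" "sets M2 = sets (\<Pi>\<^sub>M i\<in>I. borel)"
    and eq: "\<And>\<xi>. (\<integral>x. iexp (\<Sum>i\<in>I. \<xi> i * x i) \<partial>M1) = (\<integral>x. iexp (\<Sum>i\<in>I. \<xi> i * x i) \<partial>M2)"
  shows "M1 = M2"
proof -
  interpret M1: prob_space M1 by fact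
  interpret M2: prob_space M2 by fact
  \<comment> \<open>Exponentials are traded for indicators one coordinate at a time.\<close>
  have mixed: "(\<integral>x. (\<Prod>i\<in>J. indicator (A i) (x i)) *\<^sub>R iexp (\<Sum>i\<in>I - J. \<xi> i * x i) \<partial>M1) =
        (\<integral>x. (\<Prod>i\<in>J. indicator (A i) (x i)) *\<^sub>R iexp (\<Sum>i\<in>I - J. \<xi> i * x i) \<partial>M2)"
    if "J \<subseteq> I" "\<And>i. A i \<in> sets borel" for J \<xi> and A :: "'i \<Rightarrow> real set"
    using finite_subset[OF that(1) I] that
  proof (induction J arbitrary: \<xi> rule: finite_induct)
    case empty
    then show ?case using eq[of \<xi>] by simp
  next
    case (insert j J)
    then have j: "j \<in> I" "J \<subseteq> I" and [measurable]: "\<And>i. A i \<in> sets borel" by auto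
    let ?V = "\<lambda>x. \<Prod>i\<in>J. indicator (A i) (x i) :: real"
    let ?Y = "\<lambda>x. \<Sum>i\<in>I - insert j J. \<xi> i * x i"
    have [measurable]: "(\<lambda>x. x i) \<in> borel_measurable M1" "(\<lambda>x. x i) \<in> borel_measurable M2" if "i \<in> I" for i
      using that by measurable
    have V: "0 \<le> ?V x" "?V x \<le> 1" for x
      by (auto intro: prod_nonneg prod_le_1)
    have "(\<integral>x. (indicator (A j) (x j) * ?V x) *\<^sub>R iexp (?Y x) \<partial>M1) =
          (\<integral>x. (indicator (A j) (x j) * ?V x) *\<^sub>R iexp (?Y x) \<partial>M2)"
    proof (rule indicator_iexp_unique)
      show "(\<lambda>x. x j) \<in> borel_measurable M1" "(\<lambda>x. x j) \<in> borel_measurable M2"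
        using j by measurable
      show "?Y \<in> borel_measurable M1" "?Y \<in> borel_measurable M2"
        by (intro borel_measurable_sum; measurable)+
      have "?V \<in> borel_measurable M1" "?V \<in> borel_measurable M2"
        using j by (intro borel_measurable_prod; measurable; auto)+
      then show "integrable M1 ?V" "integrable M2 ?V"
        using V by (auto intro: M1.integrable_const_bound[of _ 1] M2.integrable_const_bound[of _ 1])
      fix t r
      \<comment> \<open>Coordinate \<open>j\<close> still sits in the exponent of the induction
        hypothesis, so \<open>t\<close> becomes its frequency while \<open>r\<close> rescales the
        others. This is why the induction keeps \<open>\<xi>\<close> arbitrary.\<close>
      let ?\<xi> = "(\<lambda>i. r * \<xi> i)(j := t)"
      have *: "t * x j + r * ?Y x = (\<Sum>i\<in>I - J. ?\<xi> i * x i)" for x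
      proof -
        have "(\<Sum>i\<in>I - J. ?\<xi> i * x i) = (\<Sum>i\<in>insert j (I - insert j J). ?\<xi> i * x i)"
          using j insert.hyps by (intro sum.cong) auto
        also have "\<dots> = t * x j + (\<Sum>i\<in>I - insert j J. ?\<xi> i * x i)"
          using I by (subst sum.insert) auto
        also have "(\<Sum>i\<in>I - insert j J. ?\<xi> i * x i) = r * ?Y x"
          unfolding sum_distrib_left by (intro sum.cong) auto
        finally show ?thesis by simp
      qed
      show "(\<integral>x. ?V x *\<^sub>R iexp (t * x j + r * ?Y x) \<partial>M1) = (\<integral>x. ?V x *\<^sub>R iexp (t * x j + r * ?Y x) \<partial>M2)"
        unfolding * by (rule insert.IH) (use insert.prems in auto)
    qed (use V insert.prems in auto)
    then show ?case using insert.hyps by simp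
  qed
  \<comment> \<open>The empty sum in the exponent keeps the shape of \<open>mixed\<close> at
    \<open>J = I\<close>.\<close>
  have box: "measure M (Pi\<^sub>E I A) = Re (\<integral>x. (\<Prod>i\<in>I. indicator (A i) (x i)) *\<^sub>R iexp (\<Sum>i\<in>I - I. 0 * x i) \<partial>M)"
    if [measurable_cong]: "sets M = sets (\<Pi>\<^sub>M i\<in>I. borel)" and M: "finite_measure M" and A: "\<And>i. i \<in> I \<Longrightarrow> A i \<in> sets borel"
    for M :: "('i \<Rightarrow> real) measure" and A
  proof -
    interpret finite_measure M by fact
    \<comment> \<open>Membership in a box also requires extensionality, which the indicators of the
      coordinates do not see.\<close>
    have sp: "space M = extensional I"
      using sets_eq_imp_space_eq[OF that(1)] by (simp add: space_PiM PiE_UNIV_domain PiE_def)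
    have [measurable]: "Pi\<^sub>E I A \<in> sets M" unfolding that(1) using A I by measurable
    have "(\<integral>x. (\<Prod>i\<in>I. indicator (A i) (x i)) *\<^sub>R iexp (\<Sum>i\<in>I - I. 0 * x i) \<partial>M) = (\<integral>x. complex_of_real (indicator (Pi\<^sub>E I A) x) \<partial>M)"
      by (intro Bochner_Integration.integral_cong refl)
         (use I in \<open>auto simp: sp indicator_def scaleR_conv_of_real PiE_iff\<close>)
    also have "\<dots> = of_real (measure M (Pi\<^sub>E I A))"
      by (simp del: of_real_indicator)
    finally show ?thesis by simp
  qed
  show "M1 = M2"
  proof (rule measure_eqI_PiM_finite[OF I, where A="\<lambda>_. space (\<Pi>\<^sub>M i\<in>I. borel)"])
    fix A :: "'i \<Rightarrow> real set" assume A: "\<And>i. i \<in> I \<Longrightarrow> A i \<in> sets borel"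
    \<comment> \<open>\<open>mixed\<close> asks for a measurable set at every index, so the family
      is padded outside \<open>I\<close>.\<close>
    define A' where "A' i = (if i \<in> I then A i else {})" for i
    have "Pi\<^sub>E I A = Pi\<^sub>E I A'" by (auto simp: A'_def PiE_iff)
    moreover have A': "A' i \<in> sets borel" for i using A by (auto simp: A'_def)
    ultimately show "emeasure M1 (Pi\<^sub>E I A) = emeasure M2 (Pi\<^sub>E I A)"
      unfolding M1.emeasure_eq_measure M2.emeasure_eq_measure
      using mixed[of I A' "\<lambda>_. 0"]
      by (simp add: box[OF sets(1) M1.finite_measure_axioms A'] box[OF sets(2) M2.finite_measure_axioms A'])
  qed (use sets I in \<open>auto intro!: prod_algebraI_finite simp: space_PiM\<close>)
qed

section \<open>Centred Gaussian laws on finite and arbitrary products\<close>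

text \<open>Cholesky elimination: one index supplies one column of the factor, and what remains is
  again positive semi-definite on a smaller index set.\<close>

lemma psd_matrix_factor:
  assumes "finite I" "psd_matrix I c"
  shows "\<exists>A. \<forall>i\<in>I. \<forall>j\<in>I. c i j = (\<Sum>l\<in>I. A i l * A j l)"
  using assms
proof (induction I arbitrary: c rule: finite_induct)
  case empty
  then show ?case by simp
next
  case (insert m I)
  note sym = insert.prems[unfolded psd_matrix_def, THEN conjunct1, rule_format]
  note pos = insert.prems[unfolded psd_matrix_def, THEN conjunct2, rule_format]
  \<comment> \<open>With the value \<open>y\<close> at \<open>m\<close> left free, positivity
    becomes a statement about a polynomial in \<open>y\<close> of degree at most two. Its instances
    yield the sign of the pivot, the vanishing of the column of a zero pivot, and positivity of the
    Schur complement.\<close>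
  have quad: "0 \<le> y * y * c m m + 2 * y * (\<Sum>i\<in>I. x i * c i m) + (\<Sum>i\<in>I. \<Sum>j\<in>I. x i * c i j * x j)" for x y
  proof -
    let ?x = "x(m := y)"
    have "(\<Sum>i\<in>insert m I. \<Sum>j\<in>insert m I. ?x i * c i j * ?x j) =
        y * c m m * y + (\<Sum>j\<in>I. y * c m j * x j) + (\<Sum>i\<in>I. x i * c i m * y + (\<Sum>j\<in>I. x i * c i j * x j))"
      using insert.hyps by (simp cong: sum.cong add: sum.neutral) (auto intro!: sum.cong arg_cong2[of _ _ _ _ "(+)"])
    also have "(\<Sum>j\<in>I. y * c m j * x j) = (\<Sum>j\<in>I. x j * c j m * y)"
      by (intro sum.cong refl) (simp add: sym[of m] ac_simps)
    finally show ?thesis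
      using pos[of ?x] by (simp add: sum.distrib sum_distrib_left sum_distrib_right algebra_simps flip: sum.distrib)
  qed
  have diag: "0 \<le> c m m" using quad[of 1 "\<lambda>_. 0"] by simp
  have zero: "c i m = 0" if "c m m = 0" "i \<in> I" for i
  proof (rule ccontr)
    assume ne: "c i m \<noteq> 0"
    let ?x = "\<lambda>j. if j = i then 1 else 0 :: real"
    have "0 \<le> 2 * y * c i m + c i i" for y
      using quad[of y ?x] that insert.hyps by (simp add: if_distrib[of "\<lambda>x. x * _"] if_distrib[of "\<lambda>x. _ * x"] cong: if_cong)
    \<comment> \<open>An affine function of \<open>y\<close> with nonzero slope is not bounded
      below; at this \<open>y\<close> it equals -1.\<close>
    from this[of "- (c i i + 1) / (2 * c i m)"] show False using ne by (simp add: field_simps)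
  qed
  \<comment> \<open>Schur complement; division by \<open>c m m = 0\<close> leaves \<open>c\<close> unchanged.\<close>
  define c' where "c' i j = c i j - c i m * c j m / c m m" for i j
  have "psd_matrix I c'"
    unfolding psd_matrix_def
  proof (intro conjI ballI allI)
    fix i j assume "i \<in> I" "j \<in> I"
    then show "c' i j = c' j i" by (simp add: c'_def sym[of i j])
  next
    fix x :: "'a \<Rightarrow> real"
    define s where "s = (\<Sum>i\<in>I. x i * c i m)"
    have "(\<Sum>i\<in>I. \<Sum>j\<in>I. x i * c' i j * x j) = (\<Sum>i\<in>I. \<Sum>j\<in>I. x i * c i j * x j) - s * s / c m m"
      unfolding s_def c'_def sum_product
      by (simp add: algebra_simps sum_subtractf sum_divide_distrib)
    \<comment> \<open>For a positive pivot, \<open>- s / c m m\<close> minimises the polynomial in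
      \<open>quad\<close>, and the minimum is exactly this difference. For a zero pivot both
      quotients are 0.\<close>
    also have "0 \<le> \<dots>"
      using quad[of "- s / c m m" x] by (cases "c m m = 0") (simp_all add: s_def[symmetric] field_simps)
    finally show "0 \<le> (\<Sum>i\<in>I. \<Sum>j\<in>I. x i * c' i j * x j)" .
  qed
  then obtain A where A: "\<And>i j. i \<in> I \<Longrightarrow> j \<in> I \<Longrightarrow> c' i j = (\<Sum>l\<in>I. A i l * A j l)"
    using insert.IH by blast
  \<comment> \<open>Row \<open>m\<close> is zero outside column \<open>m\<close>. If the pivot is 0,
    the new column is 0 by the convention for division, in agreement with
    \<open>zero\<close>.\<close>
  define A' where "A' i l = (if l = m then c i m / sqrt (c m m) else if i = m then 0 else A i l)" for i l
  have "c i j = (\<Sum>l\<in>insert m I. A' i l * A' j l)" if ij: "i \<in> insert m I" "j \<in> insert m I" for i j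
  proof -
    have m: "c i m * c j m / c m m + (\<Sum>l\<in>I. if i = m \<or> j = m then 0 else A i l * A j l)
      = (\<Sum>l\<in>insert m I. A' i l * A' j l)"
      using insert.hyps diag
      by (simp add: A'_def) (auto intro!: sum.cong)
    show ?thesis
    proof (cases "i = m \<or> j = m")
      case True
      then show ?thesis
        using m ij zero sym[of i j] diag by (cases "c m m = 0") auto
    next
      case False
      then show ?thesis using m ij A[of i j] by (simp add: c'_def)
    qed
  qed
  then show ?case by blast
qed

lemma char_std_normal: "(\<integral>x. iexp (b * x) \<partial>std_normal_distribution) = of_real (exp (- b\<^sup>2 / 2))"
  using fun_cong[OF char_std_normal_distribution, of b] by (simp add: char_def)

text \<open>The centred Gaussian law with covariance \<open>c\<close>. Quantifying over finite
  \<open>J\<close> lets one predicate serve finite and infinite index sets and builds in the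
  transforms of all marginals.\<close>

definition gaussian_law :: "'i set \<Rightarrow> ('i \<Rightarrow> 'i \<Rightarrow> real) \<Rightarrow> ('i \<Rightarrow> real) measure \<Rightarrow> bool" where
  "gaussian_law I c M \<longleftrightarrow> prob_space M \<and> sets M = sets (\<Pi>\<^sub>M i\<in>I. (borel :: real measure)) \<and>
    (\<forall>J \<xi>. finite J \<longrightarrow> J \<subseteq> I \<longrightarrow> (\<integral>x. iexp (\<Sum>i\<in>J. \<xi> i * x i) \<partial>M) =
      of_real (exp (- (\<Sum>i\<in>J. \<Sum>j\<in>J. \<xi> i * c i j * \<xi> j) / 2)))"

lemma gaussian_lawD:
  assumes "gaussian_law I c M"
  shows "prob_space M" and "sets M = sets (\<Pi>\<^sub>M i\<in>I. (borel :: real measure))"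
    and "finite J \<Longrightarrow> J \<subseteq> I \<Longrightarrow> (\<integral>x. iexp (\<Sum>i\<in>J. \<xi> i * x i) \<partial>M) =
      of_real (exp (- (\<Sum>i\<in>J. \<Sum>j\<in>J. \<xi> i * c i j * \<xi> j) / 2))"
  using assms unfolding gaussian_law_def by simp_all

text \<open>A marginal is tested by setting the frequencies outside \<open>J\<close> to zero, so the
  full index set suffices.\<close>

lemma gaussian_law_finiteI:
  fixes c :: "'i \<Rightarrow> 'i \<Rightarrow> real"
  assumes "finite I" "prob_space M" "sets M = sets (\<Pi>\<^sub>M i\<in>I. (borel :: real measure))"
    and char_M: "\<And>\<xi>. (\<integral>x. iexp (\<Sum>i\<in>I. \<xi> i * x i) \<partial>M) =
      of_real (exp (- (\<Sum>i\<in>I. \<Sum>j\<in>I. \<xi> i * c i j * \<xi> j) / 2))"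
  shows "gaussian_law I c M"
  unfolding gaussian_law_def
proof (intro conjI allI impI assms(2,3))
  fix J and \<xi> :: "'i \<Rightarrow> real" assume J: "finite J" "J \<subseteq> I"
  define \<xi>' where "\<xi>' i = (if i \<in> J then \<xi> i else 0)" for i
  have ext: "(\<Sum>i\<in>I. \<xi>' i * f i) = (\<Sum>i\<in>J. \<xi> i * f i)" for f
    using J \<open>finite I\<close> by (intro sum.mono_neutral_cong_right) (auto simp: \<xi>'_def)
  have "(\<Sum>i\<in>I. \<Sum>j\<in>I. \<xi>' i * c i j * \<xi>' j) = (\<Sum>i\<in>I. \<xi>' i * (\<Sum>j\<in>I. \<xi>' j * c i j))"
    by (simp add: sum_distrib_left ac_simps)
  also have "\<dots> = (\<Sum>i\<in>J. \<Sum>j\<in>J. \<xi> i * c i j * \<xi> j)"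
    unfolding ext by (simp add: sum_distrib_left ac_simps)
  finally show "(\<integral>x. iexp (\<Sum>i\<in>J. \<xi> i * x i) \<partial>M) =
      of_real (exp (- (\<Sum>i\<in>J. \<Sum>j\<in>J. \<xi> i * c i j * \<xi> j) / 2))"
    using char_M[of \<xi>'] unfolding ext by (simp only:)
qed

lemma finite_dim_gaussian_exists:
  fixes c :: "'i \<Rightarrow> 'i \<Rightarrow> real"
  assumes J: "finite J" and c: "psd_matrix J c"
  shows "\<exists>M. gaussian_law J c M"
proof -
  obtain A where A: "\<And>i j. i \<in> J \<Longrightarrow> j \<in> J \<Longrightarrow> c i j = (\<Sum>l\<in>J. A i l * A j l)"
    using psd_matrix_factor[OF assms] by blast
  interpret N: prob_space std_normal_distribution by (rule real_dist_normal_dist[THEN real_distribution.axioms(1)])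
  interpret product_prob_space "\<lambda>_::'i. std_normal_distribution" J ..
  let ?N = "\<Pi>\<^sub>M i\<in>J. std_normal_distribution"
  define g where "g z = (\<lambda>i\<in>J. \<Sum>l\<in>J. A i l * z l)" for z :: "'i \<Rightarrow> real"
  have [measurable]: "g \<in> measurable ?N (\<Pi>\<^sub>M i\<in>J. borel)"
    unfolding g_def by measurable
  have "(\<integral>x. iexp (\<Sum>i\<in>J. \<xi> i * x i) \<partial>distr ?N (\<Pi>\<^sub>M i\<in>J. borel) g) =
      of_real (exp (- (\<Sum>i\<in>J. \<Sum>j\<in>J. \<xi> i * c i j * \<xi> j) / 2))" for \<xi>
  proof -
    \<comment> \<open>The transpose of \<open>A\<close> applied to \<open>\<xi>\<close>: its squared
      length is the quadratic form of \<open>c\<close> at \<open>\<xi>\<close>, and independence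
      turns the transform into a product over its entries.\<close>
    define b where "b l = (\<Sum>i\<in>J. \<xi> i * A i l)" for l
    have lin: "(\<Sum>i\<in>J. \<xi> i * g z i) = (\<Sum>l\<in>J. b l * z l)" for z
    proof -
      have "(\<Sum>i\<in>J. \<xi> i * g z i) = (\<Sum>i\<in>J. \<Sum>l\<in>J. \<xi> i * A i l * z l)"
        by (simp add: g_def sum_distrib_left mult.assoc)
      also have "\<dots> = (\<Sum>l\<in>J. b l * z l)"
        unfolding b_def sum_distrib_right by (rule sum.swap)
      finally show ?thesis .
    qed
    have quad: "(\<Sum>l\<in>J. (b l)\<^sup>2) = (\<Sum>i\<in>J. \<Sum>j\<in>J. \<xi> i * c i j * \<xi> j)"
    proof -
      have "(\<Sum>l\<in>J. (b l)\<^sup>2) = (\<Sum>l\<in>J. \<Sum>i\<in>J. \<Sum>j\<in>J. \<xi> i * A i l * (\<xi> j * A j l))"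
        by (simp add: b_def power2_eq_square sum_product)
      also have "\<dots> = (\<Sum>i\<in>J. \<Sum>j\<in>J. \<Sum>l\<in>J. \<xi> i * A i l * (\<xi> j * A j l))"
        by (subst sum.swap, rule sum.cong[OF refl], rule sum.swap)
      also have "\<dots> = (\<Sum>i\<in>J. \<Sum>j\<in>J. \<xi> i * c i j * \<xi> j)"
        by (intro sum.cong refl) (simp add: A sum_distrib_left sum_distrib_right ac_simps)
      finally show ?thesis .
    qed
    have "(\<integral>x. iexp (\<Sum>i\<in>J. \<xi> i * x i) \<partial>distr ?N (\<Pi>\<^sub>M i\<in>J. borel) g) =
        (\<integral>z. iexp (\<Sum>l\<in>J. b l * z l) \<partial>?N)"
      by (subst integral_distr) (simp_all only: lin, measurable)
    also have "\<dots> = (\<integral>z. (\<Prod>l\<in>J. iexp (b l * z l)) \<partial>?N)"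
      by (simp add: sum_distrib_left exp_sum J)
    also have "\<dots> = (\<Prod>l\<in>J. \<integral>x. iexp (b l * x) \<partial>std_normal_distribution)"
      by (rule product_integral_prod[OF J N.integrable_iexp]) (simp_all del: of_real_mult)
    also have "\<dots> = of_real (exp (- (\<Sum>l\<in>J. (b l)\<^sup>2) / 2))"
      by (simp only: char_std_normal) (simp add: exp_sum J sum_negf[symmetric] sum_divide_distrib flip: of_real_prod)
    finally show ?thesis by (simp only: quad)
  qed
  moreover have "prob_space (distr ?N (\<Pi>\<^sub>M i\<in>J. borel) g)"
    by (rule prob_space_distr) measurable
  ultimately have "gaussian_law J c (distr ?N (\<Pi>\<^sub>M i\<in>J. borel) g)"
    by (intro gaussian_law_finiteI J) simp_all
  then show ?thesis by blast
qed

lemma gaussian_law_exists: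
  fixes c :: "'i \<Rightarrow> 'i \<Rightarrow> real"
  assumes c: "\<And>J. finite J \<Longrightarrow> J \<subseteq> I \<Longrightarrow> psd_matrix J c"
  shows "\<exists>M. gaussian_law I c M"
proof -
  define P where "P J = (SOME M. gaussian_law J c M)" for J
  have law_P: "gaussian_law J c (P J)" if "finite J" "J \<subseteq> I" for J
    unfolding P_def using finite_dim_gaussian_exists[OF that(1) c[OF that]] by (rule someI_ex)
  note P = gaussian_lawD(1)[OF law_P] and sets_P = gaussian_lawD(2)[OF law_P]
  \<comment> \<open>The laws \<open>P J\<close> are chosen separately for each \<open>J\<close>, so
    consistency rests on uniqueness: the law chosen for \<open>H\<close> already prescribes the
    transform on every subset \<open>J\<close>.\<close>
  have restr: "P J = distr (P H) (\<Pi>\<^sub>M i\<in>J. borel) (\<lambda>f. restrict f J)"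
    if "J \<subseteq> H" "finite H" "H \<subseteq> I" for J H
  proof (rule measure_eqI_char_PiM)
    have J: "finite J" "J \<subseteq> I" using that finite_subset by auto
    show "finite J" "prob_space (P J)" "sets (P J) = sets (\<Pi>\<^sub>M i\<in>J. borel)" using J P sets_P by auto
    interpret H: prob_space "P H" using that P by auto
    have sets_H [measurable_cong]: "sets (P H) = sets (\<Pi>\<^sub>M i\<in>H. borel)" using that sets_P by auto
    have [measurable]: "(\<lambda>f. restrict f J) \<in> measurable (P H) (\<Pi>\<^sub>M i\<in>J. borel)"
      using that by (simp add: measurable_restrict_subset measurable_cong_sets[OF sets_H refl])
    show "prob_space (distr (P H) (\<Pi>\<^sub>M i\<in>J. borel) (\<lambda>f. restrict f J))"
      by (rule H.prob_space_distr) measurable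
    fix \<xi> :: "'i \<Rightarrow> real"
    have "(\<integral>x. iexp (\<Sum>i\<in>J. \<xi> i * x i) \<partial>distr (P H) (\<Pi>\<^sub>M i\<in>J. borel) (\<lambda>f. restrict f J)) =
        (\<integral>x. iexp (\<Sum>i\<in>J. \<xi> i * x i) \<partial>P H)"
      by (subst integral_distr) (simp_all cong: sum.cong)
    then show "(\<integral>x. iexp (\<Sum>i\<in>J. \<xi> i * x i) \<partial>P J) =
        (\<integral>x. iexp (\<Sum>i\<in>J. \<xi> i * x i) \<partial>distr (P H) (\<Pi>\<^sub>M i\<in>J. borel) (\<lambda>f. restrict f J))"
      by (simp only: gaussian_lawD(3)[OF law_P] J that order_refl)
  qed simp
  interpret polish_projective I P
    by (intro polish_projective.intro projective_family.intro) (fact restr, fact P)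
  have sets_lim [measurable_cong]: "sets lim = sets (\<Pi>\<^sub>M i\<in>I. (borel :: real measure))"
    by simp
  have "(\<integral>x. iexp (\<Sum>i\<in>J. \<xi> i * x i) \<partial>lim) = of_real (exp (- (\<Sum>i\<in>J. \<Sum>j\<in>J. \<xi> i * c i j * \<xi> j) / 2))"
    if J: "finite J" "J \<subseteq> I" for J \<xi>
  proof -
    have [measurable]: "(\<lambda>f. restrict f J) \<in> measurable lim (\<Pi>\<^sub>M i\<in>J. borel)"
      using J by (simp add: measurable_restrict_subset measurable_cong_sets[OF sets_lim refl])
    have "distr lim (\<Pi>\<^sub>M i\<in>J. borel) (\<lambda>f. restrict f J) = P J"
    proof (rule measure_eqI)
      fix X assume "X \<in> sets (distr lim (\<Pi>\<^sub>M i\<in>J. borel) (\<lambda>f. restrict f J))"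
      then have X: "X \<in> sets (\<Pi>\<^sub>M i\<in>J. borel)" by simp
      have "emeasure (distr lim (\<Pi>\<^sub>M i\<in>J. borel) (\<lambda>f. restrict f J)) X = lim (emb I J X)"
        using X by (simp add: emeasure_distr prod_emb_def space_PiM)
      then show "emeasure (distr lim (\<Pi>\<^sub>M i\<in>J. borel) (\<lambda>f. restrict f J)) X = emeasure (P J) X"
        using J X by (simp add: emeasure_lim_emb)
    qed (use J sets_P in simp)
    then have "(\<integral>x. iexp (\<Sum>i\<in>J. \<xi> i * x i) \<partial>P J) =
      (\<integral>x. iexp (\<Sum>i\<in>J. \<xi> i * x i) \<partial>distr lim (\<Pi>\<^sub>M i\<in>J. borel) (\<lambda>f. restrict f J))"
      by simp
    also have "\<dots> = (\<integral>x. iexp (\<Sum>i\<in>J. \<xi> i * x i) \<partial>lim)"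
      by (subst integral_distr) (simp_all cong: sum.cong)
    finally show ?thesis by (simp only: gaussian_lawD(3)[OF law_P] J order_refl)
  qed
  then have "gaussian_law I c lim"
    unfolding gaussian_law_def using P.prob_space_axioms sets_lim by (intro conjI allI impI) simp_all
  then show ?thesis by blast
qed

section \<open>Scalar linear combinations and their moments\<close>

text \<open>The indices \<open>\<tau> p\<close> may repeat, since the times in a finite sample may
  coincide. Adding up the coefficients over each fibre of \<open>\<tau>\<close> gives a combination
  of distinct coordinates with the same quadratic form.\<close>

lemma law_linear_combination:
  fixes c :: "'i \<Rightarrow> 'i \<Rightarrow> real" and a :: "'s \<Rightarrow> real"
  assumes law: "gaussian_law I c M" and S: "finite S" and \<tau>: "\<tau> \<in> S \<rightarrow> I"
    and c: "psd_matrix (\<tau> ` S) c"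
  shows "0 \<le> (\<Sum>p\<in>S. \<Sum>q\<in>S. a p * c (\<tau> p) (\<tau> q) * a q)"
    and "distr M borel (\<lambda>x. \<Sum>p\<in>S. a p * x (\<tau> p)) =
      distr std_normal_distribution borel
        (\<lambda>z. sqrt (\<Sum>p\<in>S. \<Sum>q\<in>S. a p * c (\<tau> p) (\<tau> q) * a q) * z)"
proof -
  interpret prob_space M by (rule gaussian_lawD(1)[OF law])
  note sets_M [measurable_cong] = gaussian_lawD(2)[OF law]
  define \<xi> where "\<xi> i = (\<Sum>p | p \<in> S \<and> \<tau> p = i. a p)" for i
  have J: "finite (\<tau> ` S)" "\<tau> ` S \<subseteq> I" using S \<tau> by auto
  have group: "(\<Sum>i\<in>\<tau> ` S. \<xi> i * f i) = (\<Sum>p\<in>S. a p * f (\<tau> p))" for f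
  proof -
    have "(\<Sum>p\<in>S. a p * f (\<tau> p)) = (\<Sum>i\<in>\<tau> ` S. \<Sum>p | p \<in> S \<and> \<tau> p = i. a p * f (\<tau> p))"
      using S by (rule sum.image_gen)
    also have "\<dots> = (\<Sum>i\<in>\<tau> ` S. \<xi> i * f i)"
      unfolding \<xi>_def sum_distrib_right by (intro sum.cong) auto
    finally show ?thesis ..
  qed
  define v where "v = (\<Sum>p\<in>S. \<Sum>q\<in>S. a p * c (\<tau> p) (\<tau> q) * a q)"
  have v: "(\<Sum>i\<in>\<tau> ` S. \<Sum>j\<in>\<tau> ` S. \<xi> i * c i j * \<xi> j) = v"
  proof -
    have "(\<Sum>i\<in>\<tau> ` S. \<Sum>j\<in>\<tau> ` S. \<xi> i * c i j * \<xi> j) = (\<Sum>i\<in>\<tau> ` S. \<xi> i * (\<Sum>j\<in>\<tau> ` S. \<xi> j * c i j))"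
      by (simp add: sum_distrib_left ac_simps)
    also have "\<dots> = v"
      unfolding group v_def by (simp add: sum_distrib_left ac_simps)
    finally show ?thesis .
  qed
  show v_nonneg: "0 \<le> (\<Sum>p\<in>S. \<Sum>q\<in>S. a p * c (\<tau> p) (\<tau> q) * a q)"
    using c unfolding v[symmetric, unfolded v_def] by (simp add: psd_matrix_def)
  have "distr M borel (\<lambda>x. \<Sum>p\<in>S. a p * x (\<tau> p)) = distr std_normal_distribution borel (\<lambda>z. sqrt v * z)"
  proof (rule Levy_uniqueness)
    have [measurable]: "(\<lambda>x. \<Sum>p\<in>S. a p * x (\<tau> p)) \<in> borel_measurable M"
      using \<tau> by (intro borel_measurable_sum borel_measurable_times) (auto simp: measurable_cong_sets[OF sets_M refl] intro!: measurable_component_singleton)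
    show "real_distribution (distr M borel (\<lambda>x. \<Sum>p\<in>S. a p * x (\<tau> p)))"
      by (rule real_distribution_distr) measurable
    interpret N: prob_space std_normal_distribution by (rule real_dist_normal_dist[THEN real_distribution.axioms(1)])
    show "real_distribution (distr std_normal_distribution borel (\<lambda>z. sqrt v * z))"
      by (rule N.real_distribution_distr) measurable
    show "char (distr M borel (\<lambda>x. \<Sum>p\<in>S. a p * x (\<tau> p))) = char (distr std_normal_distribution borel (\<lambda>z. sqrt v * z))"
    proof
      fix t
      have "char (distr M borel (\<lambda>x. \<Sum>p\<in>S. a p * x (\<tau> p))) t = (\<integral>x. iexp (\<Sum>i\<in>\<tau> ` S. (t * \<xi> i) * x i) \<partial>M)"
        unfolding char_def by (subst integral_distr) (simp_all add: group mult.assoc flip: sum_distrib_left)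
      also have "\<dots> = of_real (exp (- (t\<^sup>2 * v) / 2))"
        unfolding gaussian_lawD(3)[OF law J] v[symmetric] by (simp add: sum_distrib_left power2_eq_square ac_simps)
      also have "\<dots> = (\<integral>z. iexp (t * sqrt v * z) \<partial>std_normal_distribution)"
        unfolding char_std_normal using v_nonneg by (simp add: power_mult_distrib v_def)
      also have "\<dots> = char (distr std_normal_distribution borel (\<lambda>z. sqrt v * z)) t"
        unfolding char_def by (subst integral_distr) (simp_all add: mult.assoc)
      finally show "char (distr M borel (\<lambda>x. \<Sum>p\<in>S. a p * x (\<tau> p))) t = char (distr std_normal_distribution borel (\<lambda>z. sqrt v * z)) t" .
    qed
  qed
  then show "distr M borel (\<lambda>x. \<Sum>p\<in>S. a p * x (\<tau> p)) =
    distr std_normal_distribution borel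
      (\<lambda>z. sqrt (\<Sum>p\<in>S. \<Sum>q\<in>S. a p * c (\<tau> p) (\<tau> q) * a q) * z)"
    by (simp only: v_def)
qed

lemma gaussian_rv_affine_std_normal:
  assumes [measurable]: "X \<in> borel_measurable M"
    and X: "distr M borel X = distr std_normal_distribution borel (\<lambda>z. s * z)"
  shows "gaussian_rv M (\<lambda>x. m + X x)"
proof -
  interpret N: prob_space std_normal_distribution by (rule real_dist_normal_dist[THEN real_distribution.axioms(1)])
  have *: "distr M borel (\<lambda>x. m + X x) = distr std_normal_distribution borel (\<lambda>z. m + s * z)"
  proof -
    have "distr M borel (\<lambda>x. m + X x) = distr (distr M borel X) borel ((+) m)"
      by (subst distr_distr) (simp_all add: comp_def)
    also have "\<dots> = distr std_normal_distribution borel (\<lambda>z. m + s * z)"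
      unfolding X by (subst distr_distr) (simp_all add: comp_def)
    finally show ?thesis .
  qed
  show ?thesis
  proof (cases "s = 0")
    case True
    then have "distr M borel (\<lambda>x. m + X x) = return borel m"
      unfolding * by (simp add: N.distr_const)
    then show ?thesis unfolding gaussian_rv_def by auto
  next
    case False
    have "distributed std_normal_distribution lborel (\<lambda>z. z) (normal_density 0 1)"
      by (simp add: distributed_def distr_id2)
    from N.normal_density_affine[OF this _ False, of m]
    have "distributed std_normal_distribution lborel (\<lambda>z. m + s * z) (normal_density m \<bar>s\<bar>)"
      by simp
    then have "distr std_normal_distribution lborel (\<lambda>z. m + s * z) = density lborel (normal_density m \<bar>s\<bar>)"
      by (simp add: distributed_def)
    \<comment> \<open>A push-forward depends on its target only through the sigma-algebra, which
      \<open>lborel\<close> shares with \<open>borel\<close>.\<close>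
    moreover have "distr M lborel (\<lambda>x. m + X x) = distr M borel (\<lambda>x. m + X x)"
        "distr std_normal_distribution lborel (\<lambda>z. m + s * z) = distr std_normal_distribution borel (\<lambda>z. m + s * z)"
      by (intro distr_cong; simp)+
    ultimately have "distributed M lborel (\<lambda>x. m + X x) (normal_density m \<bar>s\<bar>)"
      by (simp add: distributed_def *)
    then show ?thesis
      unfolding gaussian_rv_def using False by (intro disjI1 exI[of _ m] exI[of _ "\<bar>s\<bar>"]) simp
  qed
qed

lemma moments_scaled_std_normal:
  assumes [measurable]: "X \<in> borel_measurable M" and "0 \<le> v"
    and X: "distr M borel X = distr std_normal_distribution borel (\<lambda>z. sqrt v * z)"
  shows "has_bochner_integral M X 0" and "has_bochner_integral M (\<lambda>x. (X x)\<^sup>2) v"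
proof -
  let ?N = std_normal_distribution
  have transfer: "has_bochner_integral M (\<lambda>x. g (X x)) y"
    if [measurable]: "g \<in> borel_measurable borel" and "has_bochner_integral ?N (\<lambda>z. g (sqrt v * z)) y" for g :: "real \<Rightarrow> real" and y
  proof -
    have "has_bochner_integral (distr ?N borel (\<lambda>z. sqrt v * z)) g y"
      using that(2) by (simp add: has_bochner_integral_iff integrable_distr_eq integral_distr)
    then show ?thesis
      by (simp add: has_bochner_integral_iff integrable_distr_eq integral_distr flip: X)
  qed
  have "has_bochner_integral ?N (\<lambda>z. z) 0"
    using integrable_std_normal_distribution_moment[of 1] integral_std_normal_distribution_moment_odd[of 1]
    by (simp add: has_bochner_integral_iff)
  from has_bochner_integral_mult_right[OF this, of "sqrt v"] show "has_bochner_integral M X 0"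
    using transfer[of "\<lambda>x. x" 0] by simp
  have "has_bochner_integral ?N (\<lambda>z. z\<^sup>2) 1"
    using std_normal_distribution_even_moments[of 1] by (simp add: has_bochner_integral_iff)
  from has_bochner_integral_mult_right[OF this, of v] show "has_bochner_integral M (\<lambda>x. (X x)\<^sup>2) v"
    using transfer[of "\<lambda>x. x\<^sup>2" v] \<open>0 \<le> v\<close> by (simp add: power_mult_distrib)
qed

text \<open>Entries may themselves be vectors, so the rule can be applied twice to reach the entries
  of a matrix.\<close>

lemma has_bochner_integral_vec:
  fixes f :: "'a \<Rightarrow> 'b::euclidean_space ^ 'n"
  assumes "\<And>i. has_bochner_integral M (\<lambda>x. f x $ i) (y $ i)"
  shows "has_bochner_integral M f y"
proof -
  have "has_bochner_integral M (\<lambda>x. f x \<bullet> b) (y \<bullet> b)" if b: "b \<in> Basis" for b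
  proof -
    obtain i e where "b = axis i e" using b by (auto simp: Basis_vec_def)
    then show ?thesis
      using has_bochner_integral_inner_left[of e M, OF assms[of i]] by (simp add: inner_axis)
  qed
  then have "has_bochner_integral M (\<lambda>x. \<Sum>b\<in>Basis. (f x \<bullet> b) *\<^sub>R b) (\<Sum>b\<in>Basis. (y \<bullet> b) *\<^sub>R b)"
    by (intro has_bochner_integral_sum has_bochner_integral_scaleR_left)
  then show ?thesis by (simp add: euclidean_representation)
qed

section \<open>Positivity of the product kernel\<close>

text \<open>A finite set is enumerated without repetition to match the sequences in the definition;
  these have length at least 1, so the empty set is separate.\<close>

lemma covariance_function_psd_matrix:
  assumes c: "covariance_function T k" and S: "finite S" "S \<subseteq> T"
  shows "psd_matrix S k"
proof (cases "S = {}")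
  case False
  obtain t where t: "bij_betw t {..<card S} S"
    using ex_bij_betw_nat_finite[OF S(1)] by (auto simp: atLeast0LessThan)
  have "psd_matrix {..<card S} (\<lambda>i j. k (t i) (t j))"
    using c S False bij_betwE[OF t] unfolding covariance_function_def
    by (metis Suc_leI One_nat_def card_gt_0_iff lessThan_iff subset_iff)
  then have "0 \<le> (\<Sum>i<card S. \<Sum>j<card S. x (t i) * k (t i) (t j) * x (t j))" for x
    by (simp add: psd_matrix_def)
  moreover have "(\<Sum>i<card S. \<Sum>j<card S. x (t i) * k (t i) (t j) * x (t j)) = (\<Sum>i\<in>S. \<Sum>j\<in>S. x i * k i j * x j)" for x
    using sum.reindex_bij_betw[OF t, of "\<lambda>i. \<Sum>j\<in>S. x i * k i j * x j"]
    by (simp add: sum.reindex_bij_betw[OF t, of "\<lambda>j. x i * k i j * x j" for i])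
  ultimately show ?thesis
    using c S unfolding psd_matrix_def covariance_function_def by (metis subset_iff)
qed (simp add: psd_matrix_def)

text \<open>Factoring \<open>L\<close> alone splits the form into a sum over the columns
  \<open>e\<close> of the factor. Each summand is the form of \<open>k\<close> at the vector
  \<open>y e\<close>, which collects the entries of \<open>J\<close> with the same first component;
  \<open>J\<close> need not be a rectangle.\<close>

lemma psd_matrix_kronecker:
  fixes k :: "'i \<Rightarrow> 'i \<Rightarrow> real" and L :: "'d::finite \<Rightarrow> 'd \<Rightarrow> real"
  assumes k: "\<And>S. finite S \<Longrightarrow> S \<subseteq> T \<Longrightarrow> psd_matrix S k" and L: "psd_matrix UNIV L"
    and J: "finite J" "J \<subseteq> T \<times> UNIV"
  shows "psd_matrix J (\<lambda>p q. k (fst p) (fst q) * L (snd p) (snd q))"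
  unfolding psd_matrix_def
proof (intro conjI ballI allI)
  define S where "S = fst ` J"
  have S: "finite S" "S \<subseteq> T" "J \<subseteq> S \<times> UNIV" using J by (force simp: S_def)+
  have kS: "psd_matrix S k" using k S by auto
  show "k (fst p) (fst q) * L (snd p) (snd q) = k (fst q) (fst p) * L (snd q) (snd p)"
    if "p \<in> J" "q \<in> J" for p q
  proof -
    have "k (fst p) (fst q) = k (fst q) (fst p)"
      using kS that unfolding psd_matrix_def by (auto simp: S_def)
    moreover have "L (snd p) (snd q) = L (snd q) (snd p)"
      using L unfolding psd_matrix_def by auto
    ultimately show ?thesis by simp
  qed
  fix x :: "'i \<times> 'd \<Rightarrow> real"
  obtain B :: "'d \<Rightarrow> 'd \<Rightarrow> real" where B: "\<And>a b. L a b = (\<Sum>e\<in>UNIV. B a e * B b e)"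
    using psd_matrix_factor[OF _ L] by (metis UNIV_I finite)
  define y where "y e s = (\<Sum>p\<in>{p\<in>J. fst p = s}. x p * B (snd p) e)" for e s
  have y: "(\<Sum>s\<in>S. y e s * f s) = (\<Sum>p\<in>J. x p * B (snd p) e * f (fst p))" for e f
  proof -
    have "(\<Sum>p\<in>J. x p * B (snd p) e * f (fst p)) = (\<Sum>s\<in>S. \<Sum>p | p \<in> J \<and> fst p = s. x p * B (snd p) e * f (fst p))"
      unfolding S_def using J(1) by (rule sum.image_gen)
    also have "\<dots> = (\<Sum>s\<in>S. y e s * f s)"
      unfolding y_def sum_distrib_right by (intro sum.cong) auto
    finally show ?thesis ..
  qed
  have "0 \<le> (\<Sum>e\<in>UNIV. \<Sum>s\<in>S. \<Sum>t\<in>S. y e s * k s t * y e t)"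
    using kS by (intro sum_nonneg[of UNIV]) (simp add: psd_matrix_def)
  also have "\<dots> = (\<Sum>e\<in>UNIV. \<Sum>s\<in>S. y e s * (\<Sum>t\<in>S. y e t * k s t))"
    by (simp add: sum_distrib_left ac_simps)
  also have "\<dots> = (\<Sum>e\<in>UNIV. \<Sum>p\<in>J. \<Sum>q\<in>J. x p * B (snd p) e * (x q * B (snd q) e * k (fst p) (fst q)))"
    unfolding y by (simp add: sum_distrib_left)
  also have "\<dots> = (\<Sum>p\<in>J. \<Sum>q\<in>J. \<Sum>e\<in>UNIV. x p * B (snd p) e * (x q * B (snd q) e * k (fst p) (fst q)))"
    by (subst sum.swap, rule sum.cong[OF refl], rule sum.swap)
  also have "\<dots> = (\<Sum>p\<in>J. \<Sum>q\<in>J. x p * (k (fst p) (fst q) * L (snd p) (snd q)) * x q)"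
    by (intro sum.cong refl) (simp add: B sum_distrib_left sum_distrib_right ac_simps)
  finally show "0 \<le> (\<Sum>p\<in>J. \<Sum>q\<in>J. x p * (k (fst p) (fst q) * L (snd p) (snd q)) * x q)" .
qed

section \<open>Construction of the process and its moment identities\<close>

theorem theorem3p1:
  fixes T :: "'i set"
    and u :: "'i \<Rightarrow> real ^ 'd::finite"
    and k :: "'i \<Rightarrow> 'i \<Rightarrow> real"
    and \<Lambda> :: "real ^ 'd ^ 'd"
  assumes "covariance_function T k"
    and "psd_matrix UNIV (\<lambda>a b. \<Lambda> $ a $ b)"
  shows "\<exists>(P :: ('i \<Rightarrow> real ^ 'd) measure) (f :: 'i \<Rightarrow> ('i \<Rightarrow> real ^ 'd) \<Rightarrow> real ^ 'd).
    prob_space P \<and>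
    gaussian_process P T f \<and>
    (\<forall>t\<in>T. has_bochner_integral P (\<lambda>\<omega>. f t \<omega>) (u t)) \<and>
    (\<forall>s\<in>T. \<forall>l\<in>T.
       has_bochner_integral P (\<lambda>\<omega>. (f s \<omega> - u s) \<bullet> (f l \<omega> - u l)) (trace \<Lambda> * k s l)) \<and>
    (\<forall>n\<ge>1. \<forall>t :: nat \<Rightarrow> 'i. (\<forall>i<n. t i \<in> T) \<longrightarrow>
       (let M = stack_rows n u t;
            F = (\<lambda>\<omega>. stack_rows n (\<lambda>s. f s \<omega>) t);
            trK = (\<Sum>i<n. k (t i) (t i))
        in has_bochner_integral P
             (\<lambda>\<omega>. transpose_mult n (\<lambda>i. F \<omega> i - M i) (\<lambda>i. F \<omega> i - M i))
             (trK *\<^sub>R \<Lambda>)))"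
proof -
  define I :: "('i \<times> 'd) set" where "I = T \<times> UNIV"
  define c where "c p q = k (fst p) (fst q) * \<Lambda> $ snd p $ snd q" for p q
  have psd: "psd_matrix J c" if "finite J" "J \<subseteq> I" for J
    unfolding c_def using covariance_function_psd_matrix[OF assms(1)] assms(2) that
    by (intro psd_matrix_kronecker) (auto simp: I_def)
  obtain Q where Q: "gaussian_law I c Q"
    using gaussian_law_exists[OF psd] by blast
  interpret Q: prob_space Q by (rule gaussian_lawD(1)[OF Q])
  note sets_Q [measurable_cong] = gaussian_lawD(2)[OF Q]
  note lin = law_linear_combination[OF Q]
  have meas [measurable]: "(\<lambda>x. x (t, b)) \<in> borel_measurable Q" if "t \<in> T" for t b
    using that by (auto simp: measurable_cong_sets[OF sets_Q refl] I_def intro!: measurable_component_singleton)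

  \<comment> \<open>A single entry is a linear combination over a one-point index set.\<close>
  have mean: "has_bochner_integral Q (\<lambda>x. x (t, a)) 0" if "t \<in> T" for t a
    using moments_scaled_std_normal(1)[of "\<lambda>x. \<Sum>p\<in>{()}. 1 * x (t, a)" Q]
      lin[of "{()}" "\<lambda>_. (t, a)" "\<lambda>_. 1"] psd[of "{(t, a)}"] that by (simp add: I_def)
  have cov: "has_bochner_integral Q (\<lambda>x. x (s, a) * x (t, b)) (k s t * \<Lambda> $ a $ b)" if "s \<in> T" "t \<in> T" for s t a b
  proof -
    \<comment> \<open>polarisation\<close>
    define \<tau> where "\<tau> z = (if z then (s, a) else (t, b))" for z
    define w where "w \<epsilon> z = (if z then 1 else \<epsilon>)" for \<epsilon> :: real and z
    have \<tau>: "\<tau> \<in> UNIV \<rightarrow> I" using that by (auto simp: \<tau>_def I_def)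
    have "has_bochner_integral Q (\<lambda>x. (\<Sum>z\<in>UNIV. w \<epsilon> z * x (\<tau> z))\<^sup>2)
        (\<Sum>p\<in>UNIV. \<Sum>q\<in>UNIV. w \<epsilon> p * c (\<tau> p) (\<tau> q) * w \<epsilon> q)" for \<epsilon>
    proof (rule moments_scaled_std_normal(2))
      show "(\<lambda>x. \<Sum>z\<in>UNIV. w \<epsilon> z * x (\<tau> z)) \<in> borel_measurable Q"
        using that by (intro borel_measurable_sum borel_measurable_times) (auto simp: \<tau>_def)
      have psd_\<tau>: "psd_matrix (range \<tau>) c" using \<tau> by (intro psd) auto
      show "0 \<le> (\<Sum>p\<in>UNIV. \<Sum>q\<in>UNIV. w \<epsilon> p * c (\<tau> p) (\<tau> q) * w \<epsilon> q)"
        by (rule lin(1)[OF _ \<tau> psd_\<tau>]) simp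
      show "distr Q borel (\<lambda>x. \<Sum>z\<in>UNIV. w \<epsilon> z * x (\<tau> z)) = distr std_normal_distribution borel
          (\<lambda>z. sqrt (\<Sum>p\<in>UNIV. \<Sum>q\<in>UNIV. w \<epsilon> p * c (\<tau> p) (\<tau> q) * w \<epsilon> q) * z)"
        by (rule lin(2)[OF _ \<tau> psd_\<tau>]) simp
    qed
    note diff = has_bochner_integral_diff[OF this[of 1] this[of "-1"]]
    \<comment> \<open>The two quadratic forms differ by twice the sum of both off-diagonal values;
      symmetry makes this four times one of them.\<close>
    have "psd_matrix {(s, a), (t, b)} c" using that by (intro psd) (auto simp: I_def)
    then have sym: "c (t, b) (s, a) = c (s, a) (t, b)" unfolding psd_matrix_def by blast
    have "has_bochner_integral Q (\<lambda>x. 4 * (x (s, a) * x (t, b))) (4 * c (s, a) (t, b))"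
      by (rule has_bochner_integral_cong[THEN iffD1, OF refl _ _ diff])
         (simp_all add: UNIV_bool w_def \<tau>_def sym power2_eq_square algebra_simps)
    from has_bochner_integral_mult_right[OF this, of "1/4"] show ?thesis
      by (simp add: c_def)
  qed

  define g where "g x = (\<lambda>t\<in>T. u t + (\<chi> a. x (t, a)))" for x :: "'i \<times> 'd \<Rightarrow> real"
  have vec_meas: "(\<lambda>x. \<chi> a. x (t, a)) \<in> borel_measurable Q" if "t \<in> T" for t
    by (rule borel_measurable_euclidean_space[THEN iffD2])
       (use that in \<open>auto simp: Basis_vec_def inner_axis\<close>)
  have g [measurable]: "g \<in> measurable Q (path_space T)"
    unfolding g_def path_space_def using vec_meas by (intro measurable_restrict borel_measurable_add) auto
  \<comment> \<open>\<open>Q\<close> lives on families of scalars. Its image under \<open>g\<close>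
    is a measure on paths, where the process is simply evaluation; \<open>pull\<close> brings its
    integrals back to \<open>Q\<close>.\<close>
  define P where "P = distr Q (path_space T) g"
  have sets_P [measurable_cong]: "sets P = sets (path_space T)" by (simp add: P_def)
  have eval [measurable]: "(\<lambda>\<omega>. \<omega> t) \<in> borel_measurable (path_space T)" if "t \<in> T" for t
    using that unfolding path_space_def by (intro measurable_component_singleton)
  have pull: "has_bochner_integral P h y"
    if "h \<in> borel_measurable (path_space T)" "has_bochner_integral Q (\<lambda>x. h (g x)) y"
    for h :: "('i \<Rightarrow> real ^ 'd) \<Rightarrow> 'c::{banach, second_countable_topology}" and y
    using that g unfolding P_def by (simp add: has_bochner_integral_iff integrable_distr_eq integral_distr)

  have "prob_space P" unfolding P_def by (rule Q.prob_space_distr) measurable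
  \<comment> \<open>Paths in the space of \<open>P\<close> are already extensional, so restricting
    them to \<open>T\<close> changes nothing.\<close>
  have law_P: "distr P (path_space T) (\<lambda>\<omega>. \<lambda>t\<in>T. \<omega> t) = P"
  proof -
    have "distr P (path_space T) (\<lambda>\<omega>. \<lambda>t\<in>T. \<omega> t) = distr P (path_space T) (\<lambda>\<omega>. \<omega>)"
      using sets_eq_imp_space_eq[OF sets_P]
      by (intro distr_cong refl) (auto simp: path_space_def space_PiM PiE_def extensional_restrict)
    then show ?thesis by (simp add: distr_id2 sets_P)
  qed
  have "gaussian_path_measure T P"
    unfolding gaussian_path_measure_def
  proof (intro conjI allI impI sets_P)
    fix n :: nat and t :: "nat \<Rightarrow> 'i" assume "1 \<le> n" and t: "\<forall>i<n. t i \<in> T"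
    have [measurable]: "(\<lambda>f. stack_rows n f t) \<in> measurable (path_space T) (borel_mat n)"
      unfolding stack_rows_def borel_mat_def using t by (intro measurable_restrict eval) auto
    let ?\<gamma> = "distr P (borel_mat n) (\<lambda>f. stack_rows n f t)"
    show "gaussian_mat_measure n ?\<gamma>"
      unfolding gaussian_mat_measure_def
    proof (intro conjI allI)
      show "prob_space ?\<gamma>"
        by (rule prob_space.prob_space_distr[OF \<open>prob_space P\<close>]) measurable
      fix a :: "nat \<times> 'd \<Rightarrow> real"
      define S where "S = {..<n} \<times> (UNIV :: 'd set)"
      define \<tau> where "\<tau> p = (t (fst p), snd p)" for p :: "nat \<times> 'd"
      \<comment> \<open>The contribution of the mean; what is left after subtracting it is a centred
        combination of coordinates under \<open>Q\<close>.\<close>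
      define m where "m = (\<Sum>p\<in>S. a p * u (t (fst p)) $ snd p)"
      let ?X = "\<lambda>x :: nat \<Rightarrow> real ^ 'd. inner_vec n a (vec_mat x) - m"
      have S: "finite S" "\<tau> \<in> S \<rightarrow> I" using t by (auto simp: S_def \<tau>_def I_def)
      have psd_S: "psd_matrix (\<tau> ` S) c" using S by (intro psd) auto
      have [measurable]: "?X \<in> borel_measurable (borel_mat n)"
        unfolding inner_vec_def vec_mat_def borel_mat_def
        by (intro borel_measurable_diff borel_measurable_sum) (auto intro!: borel_measurable_times measurable_compose[OF _ borel_measurable_nth])
      have "?X (stack_rows n (g x) t) = (\<Sum>p\<in>S. a p * x (\<tau> p))" for x
        using t unfolding inner_vec_def S_def[symmetric] m_def sum_subtractf[symmetric]
        by (intro sum.cong refl) (auto simp: S_def vec_mat_def stack_rows_def g_def \<tau>_def algebra_simps)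
      then have "distr ?\<gamma> borel ?X = distr Q borel (\<lambda>x. \<Sum>p\<in>S. a p * x (\<tau> p))"
        unfolding P_def by (simp add: distr_distr comp_def)
      also note lin(2)[OF S psd_S]
      finally have "gaussian_rv ?\<gamma> (\<lambda>x. m + ?X x)"
        by (rule gaussian_rv_affine_std_normal[rotated]) simp
      then show "gaussian_rv ?\<gamma> (\<lambda>x. inner_vec n a (vec_mat x))" by simp
    qed simp
  qed
  then have "gaussian_process P T (\<lambda>t \<omega>. \<omega> t)"
    unfolding gaussian_process_def law_P by (auto simp: measurable_cong_sets[OF sets_P refl])
  moreover have "has_bochner_integral P (\<lambda>\<omega>. \<omega> t) (u t)" if t: "t \<in> T" for t
  proof (rule pull)
    have "has_bochner_integral Q (\<lambda>x. \<chi> a. x (t, a)) 0"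
      by (rule has_bochner_integral_vec) (simp add: mean t)
    from has_bochner_integral_add[OF _ this, of "\<lambda>_. u t" "u t"]
    show "has_bochner_integral Q (\<lambda>x. g x t) (u t)"
      using t by (simp add: g_def has_bochner_integral_iff Q.prob_space)
  qed (use t in simp)
  moreover have "has_bochner_integral P (\<lambda>\<omega>. (\<omega> s - u s) \<bullet> (\<omega> l - u l)) (trace \<Lambda> * k s l)"
    if "s \<in> T" "l \<in> T" for s l
  proof (rule pull)
    \<comment> \<open>The inner product pairs equal column indices, so only the diagonal of
      \<open>\<Lambda>\<close> enters: this is the origin of the trace.\<close>
    have "has_bochner_integral Q (\<lambda>x. \<Sum>a\<in>UNIV. x (s, a) * x (l, a)) (\<Sum>a\<in>UNIV. k s l * \<Lambda> $ a $ a)"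
      using that by (intro has_bochner_integral_sum cov)
    then show "has_bochner_integral Q (\<lambda>x. (g x s - u s) \<bullet> (g x l - u l)) (trace \<Lambda> * k s l)"
      using that by (simp add: g_def inner_vec_def Finite_Cartesian_Product.inner_vec_def trace_def sum_distrib_left mult.commute)
  qed (use that in simp)
  moreover have "has_bochner_integral P
      (\<lambda>\<omega>. transpose_mult n (\<lambda>i. stack_rows n \<omega> t i - stack_rows n u t i) (\<lambda>i. stack_rows n \<omega> t i - stack_rows n u t i))
      ((\<Sum>i<n. k (t i) (t i)) *\<^sub>R \<Lambda>)"
    if t: "\<forall>i<n. t i \<in> T" for n and t :: "nat \<Rightarrow> 'i"
  proof (intro has_bochner_integral_vec pull)
    fix a b
    have eq: "transpose_mult n (\<lambda>i. stack_rows n \<omega> t i - stack_rows n u t i)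
        (\<lambda>i. stack_rows n \<omega> t i - stack_rows n u t i) $ a $ b =
      (\<Sum>i<n. (\<omega> (t i) - u (t i)) $ a * (\<omega> (t i) - u (t i)) $ b)" for \<omega>
      by (simp add: transpose_mult_def stack_rows_def)
    show "(\<lambda>\<omega>. transpose_mult n (\<lambda>i. stack_rows n \<omega> t i - stack_rows n u t i)
        (\<lambda>i. stack_rows n \<omega> t i - stack_rows n u t i) $ a $ b) \<in> borel_measurable (path_space T)"
      unfolding eq using t by (intro borel_measurable_sum borel_measurable_times measurable_compose[OF _ borel_measurable_nth]) auto
    \<comment> \<open>Here equal times are paired instead, so the diagonal of the kernel matrix is
      summed while the entry of \<open>\<Lambda>\<close> stays fixed.\<close>
    have "has_bochner_integral Q (\<lambda>x. \<Sum>i<n. x (t i, a) * x (t i, b)) (\<Sum>i<n. k (t i) (t i) * \<Lambda> $ a $ b)"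
      using t by (intro has_bochner_integral_sum cov) auto
    then show "has_bochner_integral Q (\<lambda>x. transpose_mult n (\<lambda>i. stack_rows n (g x) t i - stack_rows n u t i)
        (\<lambda>i. stack_rows n (g x) t i - stack_rows n u t i) $ a $ b) (((\<Sum>i<n. k (t i) (t i)) *\<^sub>R \<Lambda>) $ a $ b)"
      unfolding eq using t by (simp add: g_def sum_distrib_right)
  qed
  ultimately show ?thesis
    using \<open>prob_space P\<close> unfolding Let_def by (intro exI[of _ P] exI[of _ "\<lambda>t \<omega>. \<omega> t"]) blast
qed

end
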